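(* Let $\alpha: I\subset\mathbb{R}\to E^3$ be a unit speed plane curve (not a straight line) with first curvature $k_1$, principal normal $V_2$ and (constant) binormal $B$, let $\theta$ be a constant, and consider the helix surface generated by $\alpha$, $$\phi: U\subset E^2\to E^3,\qquad \phi(s,v)=\alpha(s)+v\bigl(\sin(\theta)\,V_2(s)+\cos(\theta)\,B\bigr),$$ where $1-k_1v\sin(\theta)\neq 0$. Then the Gauss curvature of $\phi$ is zero, and the mean curvature of $\phi$ is $$H=\frac12\cdot\frac{k_1\cos(\theta)}{1-k_1v\sin(\theta)}.$$
   Context: $E^3$ is $\mathbb{R}^3$ with the standard scalar product $\langle\cdot,\cdot\rangle$. The curve $\alpha$ has nowhere vanishing curvature $k_1$, so that its Frenet frame $T=V_1$, $V_2$, $B=V_3$ is defined: $T=\alpha'$, $T'=k_1V_2$, $V_2'=-k_1T$ (the torsion is zero since $\alpha$ is planar), and $B$ is constant and perpendicular to the plane of $\alpha$. The domain $U$ is an open set of pairs $(s,v)$, $s\in I$. Sign convention: the unit normal field of $\phi$ is $Z(s,v)=-\cos(\theta)V_2(s)+\sin(\theta)B$, the shape operator is $S(X)=D_XZ$ with $D$ the standard covariant derivative of $E^3$, and the mean curvature is $H=\frac12\sum_{i=1}^2\langle S(x_i),x_i\rangle$ for an orthonormal basis $\{x_1,x_2\}$ of the tangent plane. The Gauss curvature is $\det S$. *)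

theory Defs
  imports "HOL-Analysis.Analysis"
begin

section \<open>Frenet frame of a unit speed curve\<close>

definition curve_deriv :: "(real \<Rightarrow> 'a::real_normed_vector) \<Rightarrow> real \<Rightarrow> 'a" where
  "curve_deriv f s = vector_derivative f (at s)"

definition Ck_curve_on :: "nat \<Rightarrow> (real \<Rightarrow> 'a::real_normed_vector) \<Rightarrow> real set \<Rightarrow> bool" where
  "Ck_curve_on k f I \<longleftrightarrow> (\<forall>n<k. (curve_deriv ^^ n) f C1_differentiable_on I)"

definition plane_curve_on :: "(real \<Rightarrow> real^3) \<Rightarrow> real set \<Rightarrow> bool" where
  "plane_curve_on \<alpha> I \<longleftrightarrow> (\<exists>P. affine P \<and> aff_dim P = 2 \<and> \<alpha> ` I \<subseteq> P)"

definition unit_speed_on :: "(real \<Rightarrow> real^3) \<Rightarrow> real set \<Rightarrow> bool" where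
  "unit_speed_on \<alpha> I \<longleftrightarrow> (\<forall>s\<in>I. norm (curve_deriv \<alpha> s) = 1)"

text \<open>The formulas below are those for curves parametrised by arc length with non-vanishing
  curvature.\<close>

definition frenet_T :: "(real \<Rightarrow> real^3) \<Rightarrow> real \<Rightarrow> real^3" where
  "frenet_T \<alpha> = curve_deriv \<alpha>"

definition curvature1 :: "(real \<Rightarrow> real^3) \<Rightarrow> real \<Rightarrow> real" where
  "curvature1 \<alpha> s = norm (curve_deriv (frenet_T \<alpha>) s)"

definition frenet_V2 :: "(real \<Rightarrow> real^3) \<Rightarrow> real \<Rightarrow> real^3" where
  "frenet_V2 \<alpha> s = curve_deriv (frenet_T \<alpha>) s /\<^sub>R curvature1 \<alpha> s"

text \<open>For a plane curve the binormal does not depend on \<open>s\<close>; this is a consequence of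
  planarity and is not built into the definition.\<close>

definition frenet_B :: "(real \<Rightarrow> real^3) \<Rightarrow> real \<Rightarrow> real^3" where
  "frenet_B \<alpha> s = cross3 (frenet_T \<alpha> s) (frenet_V2 \<alpha> s)"


section \<open>Curvatures of a parametrised surface\<close>

text \<open>The argument \<open>Z\<close> is a unit normal field along the immersion \<open>\<phi>\<close>, as a function of the
  parameters.\<close>

definition tangent_plane :: "(real \<times> real \<Rightarrow> real^3) \<Rightarrow> real \<times> real \<Rightarrow> (real^3) set" where
  "tangent_plane \<phi> p = range (frechet_derivative \<phi> (at p))"

text \<open>\<open>S(X) = D\<^sub>X Z\<close>, with a plus sign: a tangent vector \<open>X = d\<phi>\<^sub>p(w)\<close> is sent to the
  derivative \<open>dZ\<^sub>p(w)\<close>. The vector \<open>w\<close> is unique where \<open>\<phi>\<close> is an immersion.\<close>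

definition shape_operator ::
  "(real \<times> real \<Rightarrow> real^3) \<Rightarrow> (real \<times> real \<Rightarrow> real^3) \<Rightarrow> real \<times> real \<Rightarrow> real^3 \<Rightarrow> real^3" where
  "shape_operator \<phi> Z p X =
     frechet_derivative Z (at p) (inv (frechet_derivative \<phi> (at p)) X)"

definition basis_of :: "(real^3) set \<Rightarrow> (2 \<Rightarrow> real^3) \<Rightarrow> bool" where
  "basis_of P x \<longleftrightarrow> inj x \<and> independent (range x) \<and> span (range x) = P"

definition orthonormal_basis_of :: "(real^3) set \<Rightarrow> (2 \<Rightarrow> real^3) \<Rightarrow> bool" where
  "orthonormal_basis_of P x \<longleftrightarrow>
     basis_of P x \<and> (\<forall>i j. x i \<bullet> x j = (if i = j then 1 else 0))"

text \<open>The values of the next two functions are determined only if the expression in question is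
  the same for all admissible bases and at least one such basis (and, for the determinant, a
  matrix of the shape operator, so that it maps the tangent plane to itself) exists.\<close>

definition mean_curvature ::
  "(real \<times> real \<Rightarrow> real^3) \<Rightarrow> (real \<times> real \<Rightarrow> real^3) \<Rightarrow> real \<times> real \<Rightarrow> real" where
  "mean_curvature \<phi> Z p = (THE h. \<forall>x. orthonormal_basis_of (tangent_plane \<phi> p) x \<longrightarrow>
     h = 1/2 * (\<Sum>i\<in>UNIV. shape_operator \<phi> Z p (x i) \<bullet> x i))"

text \<open>The determinant of the shape operator as an endomorphism of the tangent plane: the
  determinant of its matrix \<open>A\<close> with respect to any basis.\<close>

definition gauss_curvature ::
  "(real \<times> real \<Rightarrow> real^3) \<Rightarrow> (real \<times> real \<Rightarrow> real^3) \<Rightarrow> real \<times> real \<Rightarrow> real" where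
  "gauss_curvature \<phi> Z p = (THE K. \<forall>x (A :: real^2^2). basis_of (tangent_plane \<phi> p) x \<longrightarrow>
     (\<forall>j. shape_operator \<phi> Z p (x j) = (\<Sum>i\<in>UNIV. A $ i $ j *\<^sub>R x i)) \<longrightarrow> K = det A)"


section \<open>The helix surface generated by a plane curve\<close>

definition helix_surface :: "(real \<Rightarrow> real^3) \<Rightarrow> real \<Rightarrow> real \<times> real \<Rightarrow> real^3" where
  "helix_surface \<alpha> \<theta> = (\<lambda>(s, v).
     \<alpha> s + v *\<^sub>R (sin \<theta> *\<^sub>R frenet_V2 \<alpha> s + cos \<theta> *\<^sub>R frenet_B \<alpha> s))"

definition helix_normal :: "(real \<Rightarrow> real^3) \<Rightarrow> real \<Rightarrow> real \<times> real \<Rightarrow> real^3" where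
  "helix_normal \<alpha> \<theta> = (\<lambda>(s, v). - cos \<theta> *\<^sub>R frenet_V2 \<alpha> s + sin \<theta> *\<^sub>R frenet_B \<alpha> s)"

end

theory Submission
  imports Defs
begin

text \<open>Planarity forces the Frenet equations \<open>V\<^sub>2' = - k\<^sub>1 T\<close> and \<open>B' = 0\<close>. Hence, with
  \<open>F = sin \<theta> V\<^sub>2 + cos \<theta> B\<close>, the differentials of the surface and of its normal field are
  \<open>(a, b) \<mapsto> a (1 - k\<^sub>1 v sin \<theta>) T + b F\<close> and \<open>(a, b) \<mapsto> a k\<^sub>1 cos \<theta> T\<close>. The shape operator is
  therefore diagonal in the orthonormal basis \<open>T, F\<close> of the tangent plane, with eigenvalues
  \<open>k\<^sub>1 cos \<theta> / (1 - k\<^sub>1 v sin \<theta>)\<close> and \<open>0\<close>.\<close>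

section \<open>Curvatures from an orthonormal tangent frame\<close>

text \<open>Both curvatures depend only on the differentials of \<open>\<phi>\<close> and
  \<open>Z\<close> at \<open>p\<close>, so what remains is linear algebra in the plane spanned by
  \<open>E\<close> and \<open>F\<close>, where \<open>F\<close> lies in the kernel of the shape
  operator.\<close>

lemma curvatures_of_orthonormal_frame:
  fixes E F :: "real^3"
  assumes d\<phi>: "(\<phi> has_derivative (\<lambda>w. (fst w * m) *\<^sub>R E + snd w *\<^sub>R F)) (at p)"
    and dZ: "(Z has_derivative (\<lambda>w. (fst w * l) *\<^sub>R E)) (at p)"
    and E: "E \<bullet> E = 1" and F: "F \<bullet> F = 1" and EF: "E \<bullet> F = 0" and m: "m \<noteq> 0"
  shows "gauss_curvature \<phi> Z p = 0" and "mean_curvature \<phi> Z p = 1/2 * (l / m)"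
proof -
  have FE: "F \<bullet> E = 0" using EF by (simp add: inner_commute)
  define D where "D = (\<lambda>w::real\<times>real. (fst w * m) *\<^sub>R E + snd w *\<^sub>R F)"
  have D: "frechet_derivative \<phi> (at p) = D"
    using frechet_derivative_at[OF d\<phi>] by (simp add: D_def)
  have Z: "frechet_derivative Z (at p) = (\<lambda>w. (fst w * l) *\<^sub>R E)"
    using frechet_derivative_at[OF dZ] by simp
  have DE: "D w \<bullet> E = fst w * m" and DF: "D w \<bullet> F = snd w" for w
    using E F EF FE by (auto simp: D_def inner_add_left)
  \<comment> \<open>Injectivity gives \<open>inv D (D w) = w\<close>, so the \<open>inv\<close> in
    \<open>shape_operator\<close> picks the intended preimage.\<close>
  have injD: "inj D"
    using DE DF m by (metis injI mult_cancel_right prod_eqI)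
  have ranD: "range D = span {E, F}"
  proof (intro equalityI subsetI)
    fix X assume "X \<in> range D"
    then show "X \<in> span {E, F}"
      by (auto simp: D_def intro!: span_add intro: span_scale span_base)
  next
    fix X assume "X \<in> span {E, F}"
    then obtain a b where "X = a *\<^sub>R E + b *\<^sub>R F"
      by (auto simp: span_insert span_singleton algebra_simps)
    then have "X = D (a / m, b)" using m by (simp add: D_def)
    then show "X \<in> range D" by blast
  qed
  have tp: "tangent_plane \<phi> p = span {E, F}"
    by (simp add: tangent_plane_def D ranD)
  have S: "shape_operator \<phi> Z p X = ((X \<bullet> E) * (l / m)) *\<^sub>R E" if X: "X \<in> span {E, F}" for X
  proof -
    obtain w where w: "X = D w" using X unfolding ranD[symmetric] by (rule rangeE)
    show ?thesis
      using m by (simp add: shape_operator_def D Z w inv_f_f[OF injD] DE)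
  qed
  \<comment> \<open>A concrete admissible basis: without one, the condition inside each
    \<open>THE\<close> would hold vacuously for every value and uniqueness would fail.\<close>
  define e :: "2 \<Rightarrow> real^3" where "e i = (if i = 1 then E else F)" for i
  have "E \<noteq> 0" "F \<noteq> 0" "E \<noteq> F" using E F EF by auto
  have range_e: "range e = {E, F}"
    by (auto simp: e_def UNIV_2)
  have "independent {E, F}"
    using \<open>E \<noteq> 0\<close> \<open>F \<noteq> 0\<close> EF FE
    by (intro pairwise_orthogonal_independent) (auto simp: pairwise_def orthogonal_def)
  moreover have "inj e"
    using \<open>E \<noteq> F\<close> by (auto simp: inj_def e_def forall_2)
  ultimately have be: "basis_of (tangent_plane \<phi> p) e"
    by (simp add: basis_of_def range_e tp)
  have oe: "orthonormal_basis_of (tangent_plane \<phi> p) e"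
    using be E F EF FE by (auto simp: orthonormal_basis_of_def e_def forall_2)
  have expand: "\<exists>a b. X = a *\<^sub>R x 1 + b *\<^sub>R x 2"
    if "span (range x) = span {E, F}" "X \<in> span {E, F}" for x :: "2 \<Rightarrow> real^3" and X
  proof -
    have "X \<in> span {x 1, x 2}" using that by (simp add: UNIV_2)
    then show ?thesis by (auto simp: span_insert span_singleton algebra_simps)
  qed
  have EFs: "E \<in> span {E, F}" "F \<in> span {E, F}" by (auto intro: span_base)

  show "mean_curvature \<phi> Z p = 1/2 * (l / m)"
    unfolding mean_curvature_def
  proof (rule the_equality)
    show "\<forall>x. orthonormal_basis_of (tangent_plane \<phi> p) x \<longrightarrow>
      1/2 * (l / m) = 1/2 * (\<Sum>i\<in>UNIV. shape_operator \<phi> Z p (x i) \<bullet> x i)"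
    proof (intro allI impI)
      fix x assume x: "orthonormal_basis_of (tangent_plane \<phi> p) x"
      then have sp: "span (range x) = span {E, F}"
        and on: "x 1 \<bullet> x 1 = 1" "x 2 \<bullet> x 2 = 1" "x 1 \<bullet> x 2 = 0" "x 2 \<bullet> x 1 = 0"
        by (auto simp: orthonormal_basis_of_def basis_of_def tp)
      have xs: "x i \<in> span {E, F}" for i by (simp add: span_base flip: sp)
      \<comment> \<open>By the formula \<open>S\<close>, the trace in the basis \<open>x\<close> is
        \<open>l / m\<close> times the sum of the squared coordinates of \<open>E\<close>, and that
        sum is the squared norm of \<open>E\<close>, namely 1.\<close>
      obtain a b where c: "E = a *\<^sub>R x 1 + b *\<^sub>R x 2" using expand[OF sp EFs(1)] by blast
      have xE: "x 1 \<bullet> E = a" "x 2 \<bullet> E = b"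
        using on by (simp_all add: c inner_add_right)
      have "(a *\<^sub>R x 1 + b *\<^sub>R x 2) \<bullet> E = 1" using E c by simp
      then have "a * a + b * b = 1" by (simp add: inner_add_left xE)
      then have "l / m = (a * a + b * b) * (l / m)" by simp
      also have "\<dots> = (\<Sum>i\<in>UNIV. shape_operator \<phi> Z p (x i) \<bullet> x i)"
        using xE by (simp add: sum_2 S xs inner_commute[of E] algebra_simps)
      finally show "1/2 * (l / m) = 1/2 * (\<Sum>i\<in>UNIV. shape_operator \<phi> Z p (x i) \<bullet> x i)"
        by simp
    qed
    then show "h = 1/2 * (l / m)" if "\<forall>x. orthonormal_basis_of (tangent_plane \<phi> p) x \<longrightarrow>
      h = 1/2 * (\<Sum>i\<in>UNIV. shape_operator \<phi> Z p (x i) \<bullet> x i)" for h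
      using that oe by metis
  qed

  show "gauss_curvature \<phi> Z p = 0"
    unfolding gauss_curvature_def
  proof (rule the_equality)
    show "\<forall>x (A :: real^2^2). basis_of (tangent_plane \<phi> p) x \<longrightarrow>
      (\<forall>j. shape_operator \<phi> Z p (x j) = (\<Sum>i\<in>UNIV. A $ i $ j *\<^sub>R x i)) \<longrightarrow> 0 = det A"
    proof (intro allI impI)
      fix x and A :: "real^2^2"
      assume x: "basis_of (tangent_plane \<phi> p) x"
        and A: "\<forall>j. shape_operator \<phi> Z p (x j) = (\<Sum>i\<in>UNIV. A $ i $ j *\<^sub>R x i)"
      from x have sp: "span (range x) = span {E, F}" and ix: "independent (range x)"
        and jx: "inj x"
        by (auto simp: basis_of_def tp)
      have xs: "x i \<in> span {E, F}" for i by (simp add: span_base flip: sp)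
      have x12: "x 1 \<noteq> x 2" using jx by (simp add: inj_eq)
      have indep: "a = 0 \<and> b = 0" if ab: "a *\<^sub>R x 1 + b *\<^sub>R x 2 = 0" for a b
      proof -
        have "(if y = x 1 then a else b) = 0" if "y \<in> range x" for y
          using independentD[OF ix, of "range x" "\<lambda>y. if y = x 1 then a else b" y]
            ab x12 that by (simp add: UNIV_2)
        from this[of "x 1"] this[of "x 2"] show ?thesis using x12 by simp
      qed
      \<comment> \<open>The coordinates of \<open>F\<close> give a nonzero vector
        \<open>(a, b)\<close> in the kernel of \<open>A\<close>, which forces
        \<open>det A = 0\<close>.\<close>
      obtain a b where c: "F = a *\<^sub>R x 1 + b *\<^sub>R x 2" using expand[OF sp EFs(2)] by blast
      have c0: "a \<noteq> 0 \<or> b \<noteq> 0" using c \<open>F \<noteq> 0\<close> by auto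
      have "a * (x 1 \<bullet> E) + b * (x 2 \<bullet> E) = F \<bullet> E"
        by (subst c) (simp add: inner_add_left)
      then have "a * ((x 1 \<bullet> E) * (l / m)) + b * ((x 2 \<bullet> E) * (l / m)) = 0"
        using FE by (metis distrib_right mult.assoc mult_zero_left)
      then have "a *\<^sub>R shape_operator \<phi> Z p (x 1) + b *\<^sub>R shape_operator \<phi> Z p (x 2) = 0"
        by (simp only: S xs scaleR_scaleR scaleR_add_left[symmetric] scaleR_zero_left)
      then have "(A $ 1 $ 1 * a + A $ 1 $ 2 * b) *\<^sub>R x 1
          + (A $ 2 $ 1 * a + A $ 2 $ 2 * b) *\<^sub>R x 2 = 0"
        using A by (simp add: sum_2 algebra_simps)
      then have "A $ 1 $ 1 * a + A $ 1 $ 2 * b = 0" "A $ 2 $ 1 * a + A $ 2 $ 2 * b = 0"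
        using indep by blast+
      \<comment> \<open>Multiplication by the adjugate of \<open>A\<close>.\<close>
      then have "det A * a = 0" "det A * b = 0"
        unfolding det_2 by algebra+
      with c0 show "0 = det A" by auto
    qed
    \<comment> \<open>In the basis \<open>e\<close> the matrix is diagonal with entries
      \<open>l / m\<close> and 0; its existence pins down the value of the
      \<open>THE\<close>.\<close>
    moreover have "\<exists>A :: real^2^2. \<forall>j. shape_operator \<phi> Z p (e j) = (\<Sum>i\<in>UNIV. A $ i $ j *\<^sub>R e i)"
      using E FE EFs
      by (intro exI[of _ "\<chi> i j. if i = 1 \<and> j = 1 then l / m else 0"])
        (auto simp: forall_2 sum_2 e_def S)
    ultimately show "K = 0" if "\<forall>x (A :: real^2^2). basis_of (tangent_plane \<phi> p) x \<longrightarrow>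
      (\<forall>j. shape_operator \<phi> Z p (x j) = (\<Sum>i\<in>UNIV. A $ i $ j *\<^sub>R x i)) \<longrightarrow> K = det A" for K
      using that be by metis
  qed
qed

section \<open>Frenet equations of a plane curve\<close>

text \<open>The product rule; openness of \<open>I\<close> makes the inner product constant near
  \<open>s\<close>. Taking \<open>g = f\<close> shows that a field of constant length is orthogonal
  to its derivative.\<close>

lemma inner_deriv_add_eq_0:
  fixes f g :: "real \<Rightarrow> 'a::real_inner"
  assumes "open I" "s \<in> I" "(f has_vector_derivative f') (at s)"
    "(g has_vector_derivative g') (at s)" "\<And>t. t \<in> I \<Longrightarrow> f t \<bullet> g t = c"
  shows "f s \<bullet> g' + f' \<bullet> g s = 0"
proof -
  have "((\<lambda>t. f t \<bullet> g t) has_vector_derivative f s \<bullet> g' + f' \<bullet> g s) (at s)"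
    using assms(3,4)
    by (rule bounded_bilinear.has_vector_derivative[OF bounded_bilinear_inner])
  then have "((\<lambda>t. c) has_vector_derivative f s \<bullet> g' + f' \<bullet> g s) (at s)"
    by (rule has_vector_derivative_transform_within_open[OF _ assms(1,2)]) (use assms(5) in auto)
  then show ?thesis
    using has_vector_derivative_const vector_derivative_unique_at by blast
qed

lemma inner_deriv_eq_0:
  fixes f :: "real \<Rightarrow> 'a::real_inner"
  assumes "open I" "s \<in> I" "(f has_vector_derivative f') (at s)" "\<And>t. t \<in> I \<Longrightarrow> n \<bullet> f t = c"
  shows "n \<bullet> f' = 0"
  using inner_deriv_add_eq_0[OF assms(1,2) has_vector_derivative_const assms(3,4)] by simp

text \<open>Three nonzero pairwise orthogonal vectors span the space, and \<open>w\<close> minus its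
  \<open>T\<close> component is orthogonal to all three, hence to itself.\<close>

lemma orthogonal_expansion_3:
  fixes T V n w :: "real^3"
  assumes "T \<bullet> T = 1" "V \<noteq> 0" "n \<noteq> 0" "T \<bullet> V = 0" "n \<bullet> T = 0" "n \<bullet> V = 0"
    and "n \<bullet> w = 0" "V \<bullet> w = 0"
  shows "w = (T \<bullet> w) *\<^sub>R T"
proof -
  have "T \<noteq> 0" using assms(1) by auto
  have ind: "independent {T, V, n}"
    using assms \<open>T \<noteq> 0\<close>
    by (intro pairwise_orthogonal_independent)
      (auto simp: pairwise_def orthogonal_def inner_commute)
  have "T \<noteq> V" "T \<noteq> n" "V \<noteq> n"
    using assms(2-6) by auto
  then have "card {T, V, n} = 3" by simp
  then have sp: "span {T, V, n} = UNIV"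
    using card_eq_dim[of "{T, V, n}" UNIV] ind by (simp add: top.extremum_uniqueI)
  have "orthogonal (w - (T \<bullet> w) *\<^sub>R T) y" if "y \<in> {T, V, n}" for y
    using that assms
    by (auto simp: orthogonal_def inner_diff_right inner_commute[of _ y] inner_commute[of V T])
  then have "orthogonal (w - (T \<bullet> w) *\<^sub>R T) y" for y
    using orthogonal_to_span[of y "{T, V, n}"] sp by blast
  then have "w - (T \<bullet> w) *\<^sub>R T = 0" using orthogonal_self by blast
  then show ?thesis by simp
qed

text \<open>A normal \<open>n\<close> of the plane is orthogonal to \<open>T\<close> and
  \<open>V\<close>, and so to the derivative of \<open>V\<close>. That derivative is also orthogonal
  to the unit field \<open>V\<close>, so only its \<open>T\<close> component is left.\<close>

lemma plane_curve_frenet: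
  fixes \<alpha> :: "real \<Rightarrow> real^3"
  assumes I: "open I" and C3: "Ck_curve_on 3 \<alpha> I" and us: "unit_speed_on \<alpha> I"
    and pl: "plane_curve_on \<alpha> I" and k: "\<forall>s\<in>I. curvature1 \<alpha> s \<noteq> 0" and s: "s \<in> I"
  shows "(\<alpha> has_vector_derivative frenet_T \<alpha> s) (at s)"
    and "(frenet_V2 \<alpha> has_vector_derivative - curvature1 \<alpha> s *\<^sub>R frenet_T \<alpha> s) (at s)"
    and "(frenet_B \<alpha> has_vector_derivative 0) (at s)"
    and "frenet_T \<alpha> s \<bullet> frenet_T \<alpha> s = 1" and "frenet_V2 \<alpha> s \<bullet> frenet_V2 \<alpha> s = 1"
    and "frenet_T \<alpha> s \<bullet> frenet_V2 \<alpha> s = 0"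
proof -
  define T where "T = frenet_T \<alpha>"
  define V where "V = frenet_V2 \<alpha>"
  define \<kappa> where "\<kappa> = curvature1 \<alpha>"
  define T' where "T' = curve_deriv T"
  have diff: "((curve_deriv ^^ n) \<alpha> has_vector_derivative (curve_deriv ^^ Suc n) \<alpha> t) (at t)"
    if "n < 3" "t \<in> I" for n t
  proof -
    have "(curve_deriv ^^ n) \<alpha> differentiable at t"
      using C3 that by (auto simp: Ck_curve_on_def C1_differentiable_on_eq)
    then show ?thesis
      by (simp add: vector_derivative_works curve_deriv_def)
  qed
  have dT: "(\<alpha> has_vector_derivative T t) (at t)" if "t \<in> I" for t
    using diff[of 0 t] that by (simp add: T_def frenet_T_def)
  have dT': "(T has_vector_derivative T' t) (at t)" if "t \<in> I" for t
    using diff[of 1 t] that by (simp add: T'_def T_def frenet_T_def)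
  have dT'': "(T' has_vector_derivative curve_deriv T' t) (at t)" if "t \<in> I" for t
    using diff[of 2 t] that
    by (simp add: T'_def T_def frenet_T_def numeral_2_eq_2)
  have \<kappa>: "\<kappa> t = norm (T' t)" "\<kappa> t \<noteq> 0" if "t \<in> I" for t
    using k that by (auto simp: \<kappa>_def curvature1_def T'_def T_def)
  have V: "V t = T' t /\<^sub>R \<kappa> t" for t
    by (simp add: V_def frenet_V2_def T'_def T_def \<kappa>_def)
  have T'V: "T' t = \<kappa> t *\<^sub>R V t" if "t \<in> I" for t
    using \<kappa>(2)[OF that] by (simp add: V)
  have TT: "T t \<bullet> T t = 1" if "t \<in> I" for t
    using us that by (auto simp: unit_speed_on_def T_def frenet_T_def dot_square_norm)
  have VV: "V t \<bullet> V t = 1" if "t \<in> I" for t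
    using \<kappa>[OF that] by (simp add: V dot_square_norm power2_eq_square)
  have TV: "T t \<bullet> V t = 0" if "t \<in> I" for t
    using inner_deriv_add_eq_0[OF I that dT'[OF that] dT'[OF that] TT]
    by (simp add: V inner_commute)

  obtain P where P: "aff_dim P = 2" "affine P" "\<alpha> ` I \<subseteq> P"
    using pl unfolding plane_curve_on_def by blast
  \<comment> \<open>Codimension one turns the plane into a level set of the inner product with some
    \<open>n\<close>, which can be differentiated along the curve.\<close>
  have "aff_dim P = int (DIM(real^3) - 1)" using P(1) by simp
  then have "\<exists>n c. n \<noteq> 0 \<and> affine hull P = {x. n \<bullet> x = c}"
    by (rule aff_dim_eq_hyperplane[THEN iffD1])
  then obtain n c where n: "n \<noteq> 0" "affine hull P = {x. n \<bullet> x = c}" by (elim exE conjE)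
  have n\<alpha>: "n \<bullet> \<alpha> t = c" if "t \<in> I" for t
  proof -
    have "\<alpha> t \<in> affine hull P" using that P(3) by (intro hull_inc) auto
    then show ?thesis by (simp add: n(2))
  qed
  have nT: "n \<bullet> T t = 0" if "t \<in> I" for t
    using inner_deriv_eq_0[OF I that dT[OF that] n\<alpha>] .
  have nV: "n \<bullet> V t = 0" if "t \<in> I" for t
    using inner_deriv_eq_0[OF I that dT'[OF that] nT] by (simp add: V)

  \<comment> \<open>The norm is differentiable away from 0, so nonvanishing curvature and the third
    derivative of \<open>\<alpha>\<close> make \<open>V\<close> differentiable.\<close>
  have "(\<lambda>t. norm (T' t)) differentiable at s"
    using differentiable_compose[of norm T' s UNIV]
      differentiable_norm_at[of "T' s"] \<kappa>[OF s] dT''[OF s]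
    by (metis differentiableI_vector norm_eq_zero)
  moreover have "norm (T' s) \<noteq> 0" using \<kappa>[OF s] by simp
  ultimately have "(\<lambda>t. T' t /\<^sub>R norm (T' t)) differentiable at s"
    using differentiableI_vector[OF dT''[OF s]]
    by (intro differentiable_scaleR differentiable_inverse)
  moreover have "V = (\<lambda>t. T' t /\<^sub>R norm (T' t))"
    by (auto simp: V \<kappa>_def curvature1_def T'_def T_def)
  ultimately obtain w where w: "(V has_vector_derivative w) (at s)"
    using vector_derivative_works by metis
  have nw: "n \<bullet> w = 0" using inner_deriv_eq_0[OF I s w nV] .
  have Vw: "V s \<bullet> w = 0"
    using inner_deriv_add_eq_0[OF I s w w VV] by (simp add: inner_commute)
  \<comment> \<open>Differentiate the orthogonality of \<open>T\<close> and \<open>V\<close>, using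
    that \<open>T'\<close> is \<open>\<kappa>\<close> times \<open>V\<close>.\<close>
  have Tw: "T s \<bullet> w = - \<kappa> s"
    using inner_deriv_add_eq_0[OF I s dT'[OF s] w TV] VV[OF s] by (simp add: T'V[OF s])
  have "V s \<noteq> 0" using VV[OF s] by auto
  then have w': "w = - \<kappa> s *\<^sub>R T s"
    using orthogonal_expansion_3[OF TT[OF s] _ n(1) TV[OF s] nT[OF s] nV[OF s] nw Vw] Tw by simp
  have "((\<lambda>t. cross3 (T t) (V t)) has_vector_derivative
      cross3 (T s) w + cross3 (T' s) (V s)) (at s)"
    using dT'[OF s] w
    by (rule bounded_bilinear.has_vector_derivative[OF bilinear_conv_bounded_bilinear[THEN iffD1, OF bilinear_cross]])
  \<comment> \<open>Each summand is a cross product of parallel vectors.\<close>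
  moreover have "cross3 (T s) w + cross3 (T' s) (V s) = 0"
    by (simp add: T'V[OF s] w' cross_mult_left cross_mult_right)
  moreover have "frenet_B \<alpha> = (\<lambda>t. cross3 (T t) (V t))"
    by (auto simp: frenet_B_def T_def V_def)
  ultimately show "(frenet_B \<alpha> has_vector_derivative 0) (at s)" by simp
  show "(\<alpha> has_vector_derivative frenet_T \<alpha> s) (at s)" using dT[OF s] by (simp add: T_def)
  show "(frenet_V2 \<alpha> has_vector_derivative - curvature1 \<alpha> s *\<^sub>R frenet_T \<alpha> s) (at s)"
    using w w' by (simp add: V_def T_def \<kappa>_def)
  show "frenet_T \<alpha> s \<bullet> frenet_T \<alpha> s = 1" "frenet_V2 \<alpha> s \<bullet> frenet_V2 \<alpha> s = 1"
    "frenet_T \<alpha> s \<bullet> frenet_V2 \<alpha> s = 0"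
    using TT[OF s] VV[OF s] TV[OF s] by (auto simp: T_def V_def)
qed

section \<open>Curvatures of the helix surface\<close>

theorem theorem5p2:
  fixes \<alpha> :: "real \<Rightarrow> real^3" and I :: "real set" and U :: "(real \<times> real) set" and \<theta> :: real
  assumes "open I" and "is_interval I"
    and "Ck_curve_on 3 \<alpha> I"
    and "unit_speed_on \<alpha> I"
    and "plane_curve_on \<alpha> I"
    and "\<forall>s\<in>I. curvature1 \<alpha> s \<noteq> 0"
    and "open U" and "U \<subseteq> I \<times> UNIV"
    and "\<forall>(s, v)\<in>U. 1 - curvature1 \<alpha> s * v * sin \<theta> \<noteq> 0"
  shows "\<forall>(s, v)\<in>U.
    gauss_curvature (helix_surface \<alpha> \<theta>) (helix_normal \<alpha> \<theta>) (s, v) = 0 \<and>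
    mean_curvature (helix_surface \<alpha> \<theta>) (helix_normal \<alpha> \<theta>) (s, v) =
      1/2 * (curvature1 \<alpha> s * cos \<theta> / (1 - curvature1 \<alpha> s * v * sin \<theta>))"
proof safe
  fix s v assume sv: "(s, v) \<in> U"
  then have s: "s \<in> I" and m: "1 - curvature1 \<alpha> s * v * sin \<theta> \<noteq> 0"
    using assms(8,9) by auto
  define T V B \<kappa> where defs: "T = frenet_T \<alpha> s" "V = frenet_V2 \<alpha> s" "B = frenet_B \<alpha> s"
    "\<kappa> = curvature1 \<alpha> s"
  note fr = plane_curve_frenet[OF assms(1,3-6) s, folded defs]
  \<comment> \<open>Lagrange's identity for the norm of a cross product.\<close>
  have BB: "B \<bullet> B = 1"
    using norm_cross[of T V] fr(4-6) by (simp add: defs frenet_B_def dot_square_norm)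
  have BT: "B \<bullet> T = 0" "T \<bullet> B = 0" "B \<bullet> V = 0" "V \<bullet> B = 0"
    by (simp_all add: defs frenet_B_def dot_cross_self)
  define F where "F = sin \<theta> *\<^sub>R V + cos \<theta> *\<^sub>R B"
  have FF: "F \<bullet> F = 1"
    using fr(5) BB BT
    by (simp add: F_def inner_add_left inner_add_right power2_eq_square[symmetric])
  have TF: "T \<bullet> F = 0"
    using fr(6) BT by (simp add: F_def inner_add_right)
  \<comment> \<open>Regards a field along the curve as a function of \<open>(s, v)\<close> constant
    in \<open>v\<close>, so that the Frenet equations can serve as derivative rules on the parameter
    domain.\<close>
  have pull: "((\<lambda>p::real\<times>real. f (fst p)) has_derivative (\<lambda>w. fst w *\<^sub>R f')) (at (s, v))"
    if "(f has_vector_derivative f') (at s)" for f :: "real \<Rightarrow> real^3" and f'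
    using has_derivative_compose[OF has_derivative_fst[OF has_derivative_ident], of f]
      that by (fastforce simp: has_vector_derivative_def)
  note [derivative_intros] = pull[OF fr(1)] pull[OF fr(2)] pull[OF fr(3)]
  \<comment> \<open>The derivative in \<open>s\<close> is \<open>T\<close> plus
    \<open>v * sin \<theta>\<close> times the derivative of \<open>V\<close>, which supplies the
    factor \<open>m\<close> for the frame lemma.\<close>
  have d\<phi>: "(helix_surface \<alpha> \<theta> has_derivative
      (\<lambda>w. (fst w * (1 - \<kappa> * v * sin \<theta>)) *\<^sub>R T + snd w *\<^sub>R F)) (at (s, v))"
    unfolding helix_surface_def case_prod_unfold
    by (rule derivative_eq_intros refl | simp)+
      (simp add: F_def algebra_simps defs)
  have dZ: "(helix_normal \<alpha> \<theta> has_derivative (\<lambda>w. (fst w * (\<kappa> * cos \<theta>)) *\<^sub>R T)) (at (s, v))"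
    unfolding helix_normal_def case_prod_unfold
    by (rule derivative_eq_intros refl | simp)+
      (simp add: algebra_simps defs)
  note cs = curvatures_of_orthonormal_frame[OF d\<phi> dZ fr(4) FF TF m[folded defs]]
  show "gauss_curvature (helix_surface \<alpha> \<theta>) (helix_normal \<alpha> \<theta>) (s, v) = 0"
    by (rule cs(1))
  show "mean_curvature (helix_surface \<alpha> \<theta>) (helix_normal \<alpha> \<theta>) (s, v) =
      1/2 * (curvature1 \<alpha> s * cos \<theta> / (1 - curvature1 \<alpha> s * v * sin \<theta>))"
    using cs(2) by (simp add: defs)
qed

end
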